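(* Let $X$ be a space with enough arcs. If $f$ is a continuous map such that $f(X)$ is metrizable, then $f(X)$ has the $\mathcal{AF}$-property. In particular, every metrizable quotient space $X/_{\sim}$ has the $\mathcal{AF}$-property.
   Context: For a metrizable space $X$, a continuous map $f\colon X\to X$ and a point $x\in X$, the $\alpha$-limit set of $x$ is $\alpha_f(x)=\bigcap_{n\ge 0}\overline{\bigcup_{k\ge n} f^{-k}(x)}$, where $f^{-k}(x)=\{y\in X: f^k(y)=x\}$. A set $A\subseteq X$ is an $\alpha$-limit set in $X$ if $A=\alpha_f(x)$ for some continuous $f\colon X\to X$ and some $x\in X$. A metrizable space $X$ has the $\mathcal{AF}$-property if the family of $\alpha$-limit sets in $X$ coincides with the family of closed subsets of $X$ (including $\emptyset$ and $X$). An arc is a homeomorphic copy of $[0,1]$. A space with enough arcs is a nondegenerate metrizable space $X$ (i.e. one with at least two points) such that for every nonempty proper closed subset $A\subseteq X$ there is an arc in $X$ with one endpoint in $A$ and the other endpoint in $X\setminus A$. In the claim, $f$ is a continuous map defined on $X$ (with values in some topological space), and $X/_{\sim}$ denotes the quotient of $X$ by an equivalence relation $\sim$ on $X$, with the quotient topology.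
   Formalization: The image f(X), and likewise the quotient X/~, is additionally assumed to have at least two points; for a one-point image the claim fails, since the empty set is closed but is not an α-limit set. *)

theory Defs
  imports "HOL-Analysis.Analysis"
begin

definition alpha_limit :: "'a topology \<Rightarrow> ('a \<Rightarrow> 'a) \<Rightarrow> 'a \<Rightarrow> 'a set" where
  "alpha_limit X f x =
     (\<Inter>n::nat. X closure_of (\<Union>k\<in>{n..}. {y \<in> topspace X. (f ^^ k) y = x}))"

definition is_alpha_limit_set :: "'a topology \<Rightarrow> 'a set \<Rightarrow> bool" where
  "is_alpha_limit_set X A \<longleftrightarrow>
     (\<exists>f x. continuous_map X X f \<and> x \<in> topspace X \<and> A = alpha_limit X f x)"

definition AF_property :: "'a topology \<Rightarrow> bool" where
  "AF_property X \<longleftrightarrow>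
     metrizable_space X \<and> {A. is_alpha_limit_set X A} = {A. closedin X A}"

definition nondegenerate_space :: "'a topology \<Rightarrow> bool" where
  "nondegenerate_space X \<longleftrightarrow> (\<exists>x\<in>topspace X. \<exists>y\<in>topspace X. x \<noteq> y)"

definition arc_with_endpoints :: "'a topology \<Rightarrow> 'a set \<Rightarrow> 'a \<Rightarrow> 'a \<Rightarrow> bool" where
  "arc_with_endpoints X C a b \<longleftrightarrow>
     C \<subseteq> topspace X \<and>
     (\<exists>h. homeomorphic_map (top_of_set {0..1::real}) (subtopology X C) h \<and> h 0 = a \<and> h 1 = b)"

definition enough_arcs :: "'a topology \<Rightarrow> bool" where
  "enough_arcs X \<longleftrightarrow>
     metrizable_space X \<and> nondegenerate_space X \<and>
     (\<forall>A. closedin X A \<and> A \<noteq> {} \<and> A \<noteq> topspace X \<longrightarrow>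
        (\<exists>C a b. arc_with_endpoints X C a b \<and> a \<in> A \<and> b \<in> topspace X - A))"

text \<open>The points of the quotient space are the equivalence classes; a set of classes is open
  if and only if the union of its members is open in the original space.\<close>

definition quotient_topology :: "'a topology \<Rightarrow> ('a \<times> 'a) set \<Rightarrow> 'a set topology" where
  "quotient_topology X r =
     topology (\<lambda>U. U \<subseteq> topspace X // r \<and> openin X {x \<in> topspace X. r `` {x} \<in> U})"

lemma openin_quotient_topology:
  "openin (quotient_topology X r) U \<longleftrightarrow>
     U \<subseteq> topspace X // r \<and> openin X {x \<in> topspace X. r `` {x} \<in> U}"
proof -
  have "istopology (\<lambda>U. U \<subseteq> topspace X // r \<and> openin X {x \<in> topspace X. r `` {x} \<in> U})"
    unfolding istopology_def
  proof (intro conjI allI impI)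
    fix S T
    assume S: "S \<subseteq> topspace X // r \<and> openin X {x \<in> topspace X. r `` {x} \<in> S}"
      and T: "T \<subseteq> topspace X // r \<and> openin X {x \<in> topspace X. r `` {x} \<in> T}"
    have "{x \<in> topspace X. r `` {x} \<in> S \<inter> T} =
        {x \<in> topspace X. r `` {x} \<in> S} \<inter> {x \<in> topspace X. r `` {x} \<in> T}"
      by auto
    with S T show "openin X {x \<in> topspace X. r `` {x} \<in> S \<inter> T}"
      by auto
    show "S \<inter> T \<subseteq> topspace X // r"
      using S by auto
  next
    fix K
    assume K: "\<forall>U\<in>K. U \<subseteq> topspace X // r \<and> openin X {x \<in> topspace X. r `` {x} \<in> U}"
    have "{x \<in> topspace X. r `` {x} \<in> \<Union>K} = (\<Union>U\<in>K. {x \<in> topspace X. r `` {x} \<in> U})"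
      by auto
    with K show "openin X {x \<in> topspace X. r `` {x} \<in> \<Union>K}"
      by auto
    show "\<Union>K \<subseteq> topspace X // r"
      using K by auto
  qed
  then show ?thesis
    by (simp add: quotient_topology_def)
qed

lemma topspace_quotient_topology: "topspace (quotient_topology X r) = topspace X // r"
proof -
  have "{x \<in> topspace X. r `` {x} \<in> topspace X // r} = topspace X"
    by (auto intro: quotientI)
  then have "openin (quotient_topology X r) (topspace X // r)"
    by (simp add: openin_quotient_topology)
  then show ?thesis
    by (metis openin_quotient_topology openin_subset openin_topspace subset_antisym)
qed

lemma quotient_map_quotient_topology: "quotient_map X (quotient_topology X r) (\<lambda>x. r `` {x})"
  unfolding quotient_map_def topspace_quotient_topology
  by (auto simp: openin_quotient_topology quotient_def)

text \<open>In a one-point space the empty set is closed but is not an alpha-limit set, because the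
  identity is the only self-map. The AF-property can therefore only be expected of
  nondegenerate spaces.\<close>

lemma not_AF_property_singleton:
  assumes "topspace X = {p}"
  shows "\<not> AF_property X"
proof
  assume "AF_property X"
  then have "is_alpha_limit_set X {}"
    by (auto simp: AF_property_def)
  then obtain f x where f: "continuous_map X X f" and x: "x \<in> topspace X"
    and e: "{} = alpha_limit X f x"
    by (auto simp: is_alpha_limit_set_def)
  have fp: "f p = p"
    using continuous_map_image_subset_topspace [OF f] assms by auto
  have "(f ^^ k) p = p" for k
    by (induction k) (simp_all add: fp)
  then have "(\<Union>k\<in>{n..}. {y \<in> topspace X. (f ^^ k) y = x}) = {p}" for n :: nat
    using assms x by auto
  then have "alpha_limit X f x = X closure_of {p}"
    by (simp add: alpha_limit_def)
  moreover have "p \<in> X closure_of {p}"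
    using assms by (simp add: in_closure_of)
  ultimately show False
    using e by auto
qed

end

theory Submission
  imports Defs
begin

text \<open>
  Fix a closed set \<open>A\<close> in the image \<open>Y\<close>. If a continuous self-map \<open>g\<close> of \<open>Y\<close> collapses \<open>A\<close> to a
  point \<open>a \<in> A\<close> and sends no point outside \<open>A\<close> into \<open>A\<close>, then the preimage of \<open>a\<close> under
  \<open>g ^^ k\<close> is exactly \<open>A\<close> for every \<open>k \<ge> 1\<close>, and hence the \<open>\<alpha>\<close>-limit set of \<open>a\<close>
  is \<open>A\<close> (lemma \<open>alpha_limit_collapse\<close>).

  For \<open>A\<close> nonempty and proper, such a map is a composition \<open>p \<circ> u\<close>. The function \<open>u\<close> takes values in
  \<open>[0,1]\<close> and vanishes exactly on \<open>A\<close>; the distance to \<open>A\<close>, cut off at \<open>1\<close>, will do because \<open>Y\<close> is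
  metrizable. The path \<open>p\<close> starts in \<open>A\<close> and never returns to it. Such a path is the part of any path
  from \<open>A\<close> to a point outside \<open>A\<close> that follows the last visit to \<open>A\<close>. So the argument asks of \<open>Y\<close>
  only that every nonempty proper closed set can be left along a path. Continuous maps send arcs to
  paths, though not always to arcs, so this holds in every continuous image of a space with enough
  arcs: pull \<open>A\<close> back, leave the preimage along an arc, and map that arc forward.

  The two extreme closed sets come from constant maps \<open>c\<close>: all of \<open>Y\<close> is the \<open>\<alpha>\<close>-limit set
  of \<open>c\<close>, and the empty set is that of any other point, which exists by nondegeneracy.
\<close>

section \<open>Realizing a closed set by collapsing it\<close>

lemma closedin_alpha_limit: "closedin Y (alpha_limit Y g x)"
  unfolding alpha_limit_def by (rule closedin_Inter) auto

text \<open>Since \<open>a \<in> A\<close>, the two conditions make both \<open>a\<close> and \<open>A\<close> have preimage \<open>A\<close>, so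
  the preimages of \<open>a\<close> under the iterates \<open>g ^^ k\<close> stabilize from \<open>k = 1\<close> on.\<close>

lemma alpha_limit_collapse:
  assumes "closedin Y A" "a \<in> A"
    and collapse: "\<And>y. y \<in> A \<Longrightarrow> g y = a"
    and outside: "\<And>y. y \<in> topspace Y - A \<Longrightarrow> g y \<in> topspace Y - A"
  shows "alpha_limit Y g a = A"
proof -
  have sub: "A \<subseteq> topspace Y"
    using assms(1) by (rule closedin_subset)
  have pre: "(g ^^ Suc k) y = a \<longleftrightarrow> y \<in> A" if "y \<in> topspace Y" for k y
    using that
  proof (induction k arbitrary: y)
    case 0
    then show ?case
      using collapse outside \<open>a \<in> A\<close> by auto
  next
    case (Suc k)
    have "g y \<in> topspace Y" "g y \<in> A \<longleftrightarrow> y \<in> A"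
      using Suc.prems collapse outside \<open>a \<in> A\<close> sub by auto
    then show ?case
      using Suc.IH [of "g y"] by (simp add: funpow_swap1)
  qed
  have tail: "(\<Union>k\<in>{n..}. {y \<in> topspace Y. (g ^^ k) y = a}) = A" for n
  proof
    show "(\<Union>k\<in>{n..}. {y \<in> topspace Y. (g ^^ k) y = a}) \<subseteq> A"
    proof clarify
      fix k y
      assume "y \<in> topspace Y" "a = (g ^^ k) y"
      then show "y \<in> A"
        using pre [of y "k - 1"] \<open>a \<in> A\<close> by (cases k) auto
    qed
    show "A \<subseteq> (\<Union>k\<in>{n..}. {y \<in> topspace Y. (g ^^ k) y = a})"
    proof
      fix y
      assume "y \<in> A"
      then have "y \<in> {y \<in> topspace Y. (g ^^ Suc n) y = a}"
        using sub pre by blast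
      then show "y \<in> (\<Union>k\<in>{n..}. {y \<in> topspace Y. (g ^^ k) y = a})"
        by (intro UN_I [of "Suc n"]) auto
    qed
  qed
  then show ?thesis
    using \<open>closedin Y A\<close> by (simp add: alpha_limit_def closure_of_closedin)
qed

lemma alpha_limit_const_other:
  fixes c :: 'a
  assumes "x \<noteq> c"
  shows "alpha_limit Y (\<lambda>y. c) x = {}"
proof -
  have "((\<lambda>y. c) ^^ k) y \<noteq> x" if "k \<ge> 1" for k and y :: 'a
    using that assms by (cases k) auto
  then have "(\<Union>k\<in>{1..}. {y \<in> topspace Y. ((\<lambda>y. c) ^^ k) y = x}) = {}"
    by auto
  then have "Y closure_of (\<Union>k\<in>{1..}. {y \<in> topspace Y. ((\<lambda>y. c) ^^ k) y = x}) = {}"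
    by (metis closure_of_empty)
  then show ?thesis
    unfolding alpha_limit_def by blast
qed

section \<open>The ingredients of the collapsing map\<close>

text \<open>The distance to \<open>A\<close> is Lipschitz with constant \<open>1\<close>, and it is positive off \<open>A\<close> because a ball
  around each such point misses \<open>A\<close>.\<close>

lemma metrizable_space_zero_set:
  assumes "metrizable_space Y" "closedin Y A" "A \<noteq> {}"
  obtains u where "continuous_map Y (top_of_set {0..1::real}) u"
    "\<And>y. y \<in> topspace Y \<Longrightarrow> u y = 0 \<longleftrightarrow> y \<in> A"
proof -
  obtain M d where "Metric_space M d" and Y: "Y = Metric_space.mtopology M d"
    using assms(1) unfolding metrizable_space_def by blast
  then interpret Metric_space M d by simp
  have AM: "A \<subseteq> M" and clo: "closedin mtopology A"
    using assms(2) Y closedin_subset by fastforce+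
  define D where "D \<equiv> \<lambda>y. INF a\<in>A. d y a"
  have bdd [simp]: "bdd_below (d y ` A)" for y
    by (meson bdd_belowI2 nonneg)
  have lower: "D y \<le> d y a" if "a \<in> A" for y a
    unfolding D_def using that by (intro cINF_lower) auto
  have D_nonneg: "0 \<le> D y" for y
    unfolding D_def using \<open>A \<noteq> {}\<close> by (intro cINF_greatest) auto
  have D_triangle: "D x \<le> d x y + D y" if "x \<in> M" "y \<in> M" for x y
  proof -
    have "D x - d x y \<le> d y a" if "a \<in> A" for a
      using lower [OF that, of x] triangle [of x y a] \<open>x \<in> M\<close> \<open>y \<in> M\<close> AM that by force
    then have "D x - d x y \<le> D y"
      unfolding D_def using \<open>A \<noteq> {}\<close> by (intro cINF_greatest) auto
    then show ?thesis by simp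
  qed
  have "\<bar>D x - D y\<bar> \<le> d x y" if "x \<in> M" "y \<in> M" for x y
    using D_triangle [of x y] D_triangle [of y x] that commute [of x y] by linarith
  then have "Lipschitz_continuous_map Self euclidean_metric D"
    unfolding Lipschitz_continuous_map_def Self_def
    by (auto intro!: exI [of _ 1] simp: dist_real_def)
  then have cont_D: "continuous_map mtopology euclideanreal D"
    using Lipschitz_continuous_imp_continuous_map by (fastforce simp: Self_def)
  have D_zero: "D y = 0 \<longleftrightarrow> y \<in> A" if "y \<in> M" for y
  proof
    assume "y \<in> A"
    then show "D y = 0"
      using lower [of y y] D_nonneg [of y] that by simp
  next
    assume "D y = 0"
    show "y \<in> A"
    proof (rule ccontr)
      assume "y \<notin> A"
      then obtain r where "r > 0" and r: "disjnt A (mball y r)"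
        using clo \<open>y \<in> M\<close> unfolding closedin_metric by blast
      have "r \<le> d y a" if "a \<in> A" for a
        using r that AM \<open>y \<in> M\<close> by (force simp: disjnt_iff)
      then have "r \<le> D y"
        unfolding D_def using \<open>A \<noteq> {}\<close> by (intro cINF_greatest) auto
      with \<open>r > 0\<close> \<open>D y = 0\<close> show False by simp
    qed
  qed
  show ?thesis
  proof
    show "continuous_map Y (top_of_set {0..1}) (\<lambda>y. min 1 (D y))"
      using cont_D D_nonneg
      by (auto simp: Y continuous_map_in_subtopology intro!: continuous_map_real_min)
    show "min 1 (D y) = 0 \<longleftrightarrow> y \<in> A" if "y \<in> topspace Y" for y
      using that D_zero [of y] by (auto simp: Y min_def)
  qed
qed

text \<open>The set of times spent in \<open>A\<close> is compact, so there is a last one, and the path can be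
  reparametrized to start there.\<close>

lemma path_after_last_visit:
  assumes "pathin Y q" "closedin Y A" "q 0 \<in> A" "q 1 \<notin> A"
  obtains p where "pathin Y p" "\<And>t. t \<in> {0..1} \<Longrightarrow> p t \<in> A \<longleftrightarrow> t = 0"
proof -
  define S where "S \<equiv> {t \<in> {0..1}. q t \<in> A}"
  have "closedin (top_of_set {0..1}) S"
    using closedin_continuous_map_preimage [OF assms(1)[unfolded pathin_def] assms(2)]
    by (simp add: S_def)
  then have "compact S"
    by (rule closedin_compact [OF compact_Icc])
  moreover have "S \<noteq> {}"
    using assms(3) unfolding S_def by force
  ultimately obtain s where "s \<in> S" and last: "\<And>t. t \<in> S \<Longrightarrow> t \<le> s"
    using compact_attains_sup by metis
  then have s: "0 \<le> s" "s < 1" "q s \<in> A"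
    using assms(4) by (auto simp: S_def less_le)
  have range: "s + t * (1 - s) \<in> {0..1}" if "t \<in> {0..1}" for t
  proof -
    have "t * (1 - s) \<le> 1 - s"
      using that s by (intro mult_left_le_one_le) auto
    then have "s + t * (1 - s) \<le> 1"
      by linarith
    moreover have "0 \<le> s + t * (1 - s)"
      using that s by (intro add_nonneg_nonneg mult_nonneg_nonneg) auto
    ultimately show ?thesis by simp
  qed
  show ?thesis
  proof
    have "continuous_map (top_of_set {0..1}) (top_of_set {0..1}) (\<lambda>t. s + t * (1 - s))"
      using range by (auto simp: continuous_map_in_subtopology intro!: continuous_intros)
    then have "continuous_map (top_of_set {0..1}) Y (q \<circ> (\<lambda>t. s + t * (1 - s)))"
      using assms(1) unfolding pathin_def by (rule continuous_map_compose)
    then show "pathin Y (\<lambda>t. q (s + t * (1 - s)))"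
      by (simp add: pathin_def o_def)
    show "q (s + t * (1 - s)) \<in> A \<longleftrightarrow> t = 0" if "t \<in> {0..1}" for t
    proof
      assume "q (s + t * (1 - s)) \<in> A"
      then have "s + t * (1 - s) \<in> S"
        using range [OF that] unfolding S_def by blast
      then have "s + t * (1 - s) \<le> s"
        by (rule last)
      then show "t = 0"
        using that s by (auto simp: mult_le_0_iff)
    qed (use s in simp)
  qed
qed

section \<open>Spaces whose closed sets can be left along paths\<close>

lemma AF_property_if_leaving_paths:
  assumes met: "metrizable_space Y" and nondeg: "nondegenerate_space Y"
    and leave: "\<And>A. \<lbrakk>closedin Y A; A \<noteq> {}; A \<noteq> topspace Y\<rbrakk>
      \<Longrightarrow> \<exists>q. pathin Y q \<and> q 0 \<in> A \<and> q 1 \<notin> A"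
  shows "AF_property Y"
proof -
  have "is_alpha_limit_set Y A" if A: "closedin Y A" for A
  proof -
    obtain c x where cx: "c \<in> topspace Y" "x \<in> topspace Y" "x \<noteq> c"
      using nondeg unfolding nondegenerate_space_def by metis
    have const: "continuous_map Y Y (\<lambda>y. c)"
      using cx by simp
    consider "A = {}" | "A = topspace Y" | "A \<noteq> {}" "A \<noteq> topspace Y" by blast
    then show ?thesis
    proof cases
      case 1
      then have "A = alpha_limit Y (\<lambda>y. c) x"
        using cx by (simp add: alpha_limit_const_other)
      then show ?thesis
        unfolding is_alpha_limit_set_def using const cx by blast
    next
      case 2
      then have "A = alpha_limit Y (\<lambda>y. c) c"
        using alpha_limit_collapse [of Y A c "\<lambda>y. c"] A cx by auto
      then show ?thesis
        unfolding is_alpha_limit_set_def using const cx by blast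
    next
      case 3
      then obtain q where "pathin Y q" "q 0 \<in> A" "q 1 \<notin> A"
        using leave A by blast
      then obtain p where p: "pathin Y p"
        and p_in: "\<And>t. t \<in> {0..1} \<Longrightarrow> p t \<in> A \<longleftrightarrow> t = 0"
        using path_after_last_visit A by metis
      obtain u where u: "continuous_map Y (top_of_set {0..1::real}) u"
        and u_zero: "\<And>y. y \<in> topspace Y \<Longrightarrow> u y = 0 \<longleftrightarrow> y \<in> A"
        using metrizable_space_zero_set [OF met A] 3 by metis
      have u_range: "u y \<in> {0..1}" if "y \<in> topspace Y" for y
        using u that by (auto simp: continuous_map_def)
      have cont: "continuous_map Y Y (p \<circ> u)"
        using continuous_map_compose [OF u] p by (simp add: pathin_def)
      have "p 0 \<in> A"
        using p_in by simp
      have "alpha_limit Y (p \<circ> u) (p 0) = A"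
      proof (rule alpha_limit_collapse [OF A \<open>p 0 \<in> A\<close>])
        show "(p \<circ> u) y = p 0" if "y \<in> A" for y
          using that u_zero [of y] closedin_subset [OF A] by auto
        show "(p \<circ> u) y \<in> topspace Y - A" if "y \<in> topspace Y - A" for y
        proof -
          have "(p \<circ> u) y \<in> topspace Y"
            using cont that by (auto simp: continuous_map_def)
          moreover have "p (u y) \<notin> A"
            using that p_in u_zero u_range by auto
          ultimately show ?thesis by simp
        qed
      qed
      then show ?thesis
        unfolding is_alpha_limit_set_def
        using cont \<open>p 0 \<in> A\<close> closedin_subset [OF A] by blast
    qed
  qed
  then show ?thesis
    unfolding AF_property_def
    using met by (auto simp: is_alpha_limit_set_def closedin_alpha_limit)
qed

lemma AF_property_continuous_image:
  assumes X: "enough_arcs X" and f: "continuous_map X Y f" and onto: "f ` topspace X = topspace Y"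
    and met: "metrizable_space Y" and nondeg: "nondegenerate_space Y"
  shows "AF_property Y"
proof (rule AF_property_if_leaving_paths [OF met nondeg])
  fix A
  assume A: "closedin Y A" "A \<noteq> {}" "A \<noteq> topspace Y"
  define B where "B \<equiv> {x \<in> topspace X. f x \<in> A}"
  have "closedin X B"
    unfolding B_def using f A(1) by (rule closedin_continuous_map_preimage)
  moreover have "f ` B = A"
    using onto closedin_subset [OF A(1)] by (auto simp: B_def)
  then have "B \<noteq> {}" "B \<noteq> topspace X"
    using A onto by auto
  ultimately obtain C a b where arc: "arc_with_endpoints X C a b"
    and ab: "a \<in> B" "b \<in> topspace X - B"
    using X unfolding enough_arcs_def by metis
  then obtain h where h: "homeomorphic_map (top_of_set {0..1::real}) (subtopology X C) h"
    and ends: "h 0 = a" "h 1 = b"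
    unfolding arc_with_endpoints_def by metis
  have "pathin X h"
    using homeomorphic_imp_continuous_map [OF h]
    by (simp add: pathin_def continuous_map_in_subtopology)
  then have "pathin Y (f \<circ> h)"
    using f by (rule pathin_compose)
  moreover have "(f \<circ> h) 0 \<in> A" "(f \<circ> h) 1 \<notin> A"
    using ab ends by (auto simp: B_def)
  ultimately show "\<exists>q. pathin Y q \<and> q 0 \<in> A \<and> q 1 \<notin> A" by blast
qed

theorem corollary23:
  fixes X :: "'a topology"
  assumes "enough_arcs X"
  shows "(\<forall>(Z :: 'b topology) f.
            continuous_map X Z f \<and>
            metrizable_space (subtopology Z (f ` topspace X)) \<and>
            nondegenerate_space (subtopology Z (f ` topspace X)) \<longrightarrow>
            AF_property (subtopology Z (f ` topspace X))) \<and>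
         (\<forall>r. equiv (topspace X) r \<and>
            metrizable_space (quotient_topology X r) \<and>
            nondegenerate_space (quotient_topology X r) \<longrightarrow>
            AF_property (quotient_topology X r))"
proof (intro conjI allI impI; elim conjE)
  fix Z :: "'b topology" and f
  assume f: "continuous_map X Z f"
    and Y: "metrizable_space (subtopology Z (f ` topspace X))"
      "nondegenerate_space (subtopology Z (f ` topspace X))"
  have "continuous_map X (subtopology Z (f ` topspace X)) f"
    using f by (simp add: continuous_map_in_subtopology)
  moreover have "f ` topspace X = topspace (subtopology Z (f ` topspace X))"
    using continuous_map_image_subset_topspace [OF f] by auto
  ultimately show "AF_property (subtopology Z (f ` topspace X))"
    using assms Y by (intro AF_property_continuous_image)
next
  fix r
  assume Y: "metrizable_space (quotient_topology X r)"
      "nondegenerate_space (quotient_topology X r)"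
  have q: "quotient_map X (quotient_topology X r) (\<lambda>x. r `` {x})"
    by (rule quotient_map_quotient_topology)
  show "AF_property (quotient_topology X r)"
    by (rule AF_property_continuous_image [OF assms quotient_imp_continuous_map [OF q]
          quotient_imp_surjective_map [OF q] Y])
qed

end
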